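(* For positive braids $\beta$, the quantities $\mathrm{rank}(\beta)$, $\det(\beta)$, $O(\beta)$ and $U(\beta)$ are positive braid invariants; that is, if $B$ and $B'$ are positive braid diagrams representing the same positive braid, then $\mathrm{rank}(B)=\mathrm{rank}(B')$, $\det(B)=\det(B')$, $O(B)=O(B')$ and $U(B)=U(B')$.
   Context: An $n$-braid diagram $B$ ($n\ge 1$) is the planar diagram of a braid on $n$ strands, given by a word in $\sigma_1^{\pm1},\dots,\sigma_{n-1}^{\pm1}$ read from top to bottom; $\sigma_k$ (a positive crossing) is a crossing of the strands currently at positions $k$ and $k+1$ in which the strand going from position $k$ to position $k+1$ passes under the other, and $\sigma_k^{-1}$ is the same with the other strand passing under. Two $n$-braid diagrams represent the same braid if the words are equal in the braid group on $n$ strands. The strands are labelled $s_1,\dots,s_n$ from left to right at the top. A strand permutation $\pi$ of $\{1,\dots,n\}$ corresponds to the sequence of strands $\mathbf{s}=(s_{\pi(1)},\dots,s_{\pi(n)})$. The OU (over-under) matrix $M(B_{\mathbf{s}})=M_B(\pi)=(m_{ij})$ is the $n\times n$ matrix with zero diagonal whose $(i,j)$-entry for $i\neq j$ is the number of crossings of $B$ at which $s_{\pi(i)}$ passes over $s_{\pi(j)}$. The following do not depend on $\pi$: $\mathrm{rank}(B)=\mathrm{rank}\,M_B(\pi)$; $\det(B)=\det M_B(\pi)$; the over-crossing set $O(B)$, which is the multiset of the $n$ multisets $\{m_{i1},m_{i2},\dots,m_{in}\}$, $i=1,\dots,n$ (rows); and the under-crossing set $U(B)$, which is the multiset of the $n$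 multisets $\{m_{1j},m_{2j},\dots,m_{nj}\}$, $j=1,\dots,n$ (columns). A positive braid diagram is one all of whose crossings are positive (a word in the $\sigma_k$ only); a positive braid is a braid having a positive braid diagram. For a positive braid $\beta$, $\mathrm{rank}(\beta),\det(\beta),O(\beta),U(\beta)$ denote $\mathrm{rank}(B),\det(B),O(B),U(B)$ for a positive braid diagram $B$ of $\beta$. *)

theory Defs
  imports "Jordan_Normal_Form.DL_Rank"
begin
text \<open>\<open>Gen k\<close> is the letter \<open>\<sigma>\<^sub>k\<close> and \<open>GenInv k\<close> is its inverse; a diagram is a word, read from
  top to bottom. Positions and strand labels run over \<open>1..n\<close>.\<close>

datatype crossing = Gen (place: nat) | GenInv (place: nat)

definition braid_diagram :: "nat \<Rightarrow> crossing list \<Rightarrow> bool" where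
  "braid_diagram n B \<longleftrightarrow> (\<forall>c\<in>set B. 1 \<le> place c \<and> place c < n)"

definition positive_braid_diagram :: "nat \<Rightarrow> crossing list \<Rightarrow> bool" where
  "positive_braid_diagram n B \<longleftrightarrow> braid_diagram n B \<and> (\<forall>c\<in>set B. is_Gen c)"

text \<open>Equality in the braid group on \<open>n\<close> strands, given by the Artin presentation.\<close>

inductive braid_relation :: "nat \<Rightarrow> crossing list \<Rightarrow> crossing list \<Rightarrow> bool" for n where
  inv_right: "1 \<le> k \<Longrightarrow> k < n \<Longrightarrow> braid_relation n [Gen k, GenInv k] []"
| inv_left: "1 \<le> k \<Longrightarrow> k < n \<Longrightarrow> braid_relation n [GenInv k, Gen k] []"
| far: "1 \<le> i \<Longrightarrow> i + 2 \<le> j \<Longrightarrow> j < n \<Longrightarrow> braid_relation n [Gen i, Gen j] [Gen j, Gen i]"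
| braid: "1 \<le> i \<Longrightarrow> i + 1 < n \<Longrightarrow>
    braid_relation n [Gen i, Gen (i + 1), Gen i] [Gen (i + 1), Gen i, Gen (i + 1)]"

inductive braid_step :: "nat \<Rightarrow> crossing list \<Rightarrow> crossing list \<Rightarrow> bool" for n where
  "braid_diagram n u \<Longrightarrow> braid_diagram n v \<Longrightarrow> braid_relation n r r' \<Longrightarrow>
    braid_step n (u @ r @ v) (u @ r' @ v)"

definition same_braid :: "nat \<Rightarrow> crossing list \<Rightarrow> crossing list \<Rightarrow> bool" where
  "same_braid n B B' \<longleftrightarrow>
    braid_diagram n B \<and> braid_diagram n B' \<and> equivclp (braid_step n) B B'"

text \<open>\<open>crossings p B\<close> lists, from top to bottom, the pairs (over-strand, under-strand) of the
  crossings of \<open>B\<close> when the strand at position \<open>k\<close> at the top is \<open>p k\<close>. At \<open>\<sigma>\<^sub>k\<close> the strand going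
  from position \<open>k\<close> to \<open>k + 1\<close>, namely \<open>p k\<close>, passes under.\<close>

fun crossings :: "(nat \<Rightarrow> nat) \<Rightarrow> crossing list \<Rightarrow> (nat \<times> nat) list" where
  "crossings p [] = []"
| "crossings p (Gen k # B) =
    (p (k + 1), p k) # crossings (p(k := p (k + 1), k + 1 := p k)) B"
| "crossings p (GenInv k # B) =
    (p k, p (k + 1)) # crossings (p(k := p (k + 1), k + 1 := p k)) B"

definition over_count :: "crossing list \<Rightarrow> nat \<Rightarrow> nat \<Rightarrow> nat" where
  "over_count B a b = count_list (crossings id B) (a, b)"

text \<open>Matrix indices start at \<open>0\<close>, strand labels at \<open>1\<close>; \<open>\<pi>\<close> is a permutation of \<open>{1..n}\<close>.\<close>

definition ou_matrix :: "nat \<Rightarrow> crossing list \<Rightarrow> (nat \<Rightarrow> nat) \<Rightarrow> real mat" where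
  "ou_matrix n B \<pi> = mat n n (\<lambda>(i, j).
    if i = j then 0 else of_nat (over_count B (\<pi> (i + 1)) (\<pi> (j + 1))))"

definition mat_rows_mset :: "'a mat \<Rightarrow> 'a multiset multiset" where
  "mat_rows_mset A =
    {#{#A $$ (i, j). j \<in># mset_set {..<dim_col A}#}. i \<in># mset_set {..<dim_row A}#}"

definition mat_cols_mset :: "'a mat \<Rightarrow> 'a multiset multiset" where
  "mat_cols_mset A =
    {#{#A $$ (i, j). i \<in># mset_set {..<dim_row A}#}. j \<in># mset_set {..<dim_col A}#}"

text \<open>The choice of the identity as strand permutation is immaterial, see
  \<open>braid_rank_eq\<close>, \<open>braid_det_eq\<close>, \<open>over_crossing_set_eq\<close> and \<open>under_crossing_set_eq\<close> below.\<close>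

definition braid_rank :: "nat \<Rightarrow> crossing list \<Rightarrow> nat" where
  "braid_rank n B = vec_space.rank n (ou_matrix n B id)"

definition braid_det :: "nat \<Rightarrow> crossing list \<Rightarrow> real" where
  "braid_det n B = det (ou_matrix n B id)"

definition over_crossing_set :: "nat \<Rightarrow> crossing list \<Rightarrow> real multiset multiset" where
  "over_crossing_set n B = mat_rows_mset (ou_matrix n B id)"

definition under_crossing_set :: "nat \<Rightarrow> crossing list \<Rightarrow> real multiset multiset" where
  "under_crossing_set n B = mat_cols_mset (ou_matrix n B id)"

definition reindex :: "(nat \<Rightarrow> nat) \<Rightarrow> nat \<Rightarrow> nat" where
  "reindex \<pi> i = \<pi> (i + 1) - 1"

lemma reindex_bij:
  assumes "\<pi> permutes {1..n}"
  shows "bij_betw (reindex \<pi>) {..<n} {..<n}"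
proof -
  have im: "\<pi> ` {1..n} = {1..n}" and inj: "inj \<pi>"
    using assms by (auto simp: permutes_image permutes_inj)
  have in1: "\<pi> (i + 1) \<in> {1..n}" if "i < n" for i
  proof -
    have "i + 1 \<in> {1..n}" using that by auto
    then show ?thesis using im by blast
  qed
  have inj': "inj_on (reindex \<pi>) {..<n}"
  proof (rule inj_onI)
    fix i j assume "i \<in> {..<n}" "j \<in> {..<n}" "reindex \<pi> i = reindex \<pi> j"
    then have "\<pi> (i + 1) = \<pi> (j + 1)"
      using in1[of i] in1[of j] by (auto simp: reindex_def)
    then show "i = j" using inj by (auto dest: injD)
  qed
  moreover have "reindex \<pi> ` {..<n} \<subseteq> {..<n}"
    using in1 by (fastforce simp: reindex_def)
  ultimately have "reindex \<pi> ` {..<n} = {..<n}"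
    by (simp add: card_image card_subset_eq)
  with inj' show ?thesis by (simp add: bij_betw_def)
qed

lemma ou_matrix_reindex:
  assumes "\<pi> permutes {1..n}"
  shows "ou_matrix n B \<pi> = mat n n (\<lambda>(i, j). ou_matrix n B id $$ (reindex \<pi> i, reindex \<pi> j))"
proof (rule eq_matI)
  fix i j
  assume "i < dim_row (mat n n (\<lambda>(i, j). ou_matrix n B id $$ (reindex \<pi> i, reindex \<pi> j)))"
    and "j < dim_col (mat n n (\<lambda>(i, j). ou_matrix n B id $$ (reindex \<pi> i, reindex \<pi> j)))"
  then have ij: "i < n" "j < n" by auto
  have bij: "bij_betw (reindex \<pi>) {..<n} {..<n}" by (rule reindex_bij[OF assms])
  have r: "reindex \<pi> i < n" "reindex \<pi> j < n"
    using ij bij by (auto simp: bij_betw_def)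
  have e: "reindex \<pi> i = reindex \<pi> j \<longleftrightarrow> i = j"
    using ij bij by (auto simp: bij_betw_def inj_on_def)
  have "\<pi> (k + 1) = reindex \<pi> k + 1" if "k < n" for k
  proof -
    have "\<pi> (k + 1) \<in> {1..n}" using that assms by (subst permutes_in_image) auto
    then show ?thesis by (simp add: reindex_def)
  qed
  then show "ou_matrix n B \<pi> $$ (i, j) =
      mat n n (\<lambda>(i, j). ou_matrix n B id $$ (reindex \<pi> i, reindex \<pi> j)) $$ (i, j)"
    using ij r e by (simp add: ou_matrix_def)
qed (auto simp: ou_matrix_def)

lemma ou_matrix_carrier [simp]: "ou_matrix n B \<pi> \<in> carrier_mat n n"
  by (simp add: ou_matrix_def)

lemma mset_set_image_bij:
  assumes "bij_betw f A A"
  shows "{#g (f x). x \<in># mset_set A#} = {#g x. x \<in># mset_set A#}"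
proof -
  have "image_mset f (mset_set A) = mset_set A"
    using assms by (simp add: bij_betw_def image_mset_mset_set)
  then have "image_mset g (image_mset f (mset_set A)) = image_mset g (mset_set A)" by simp
  then show ?thesis by (simp add: image_mset.compositionality comp_def)
qed

lemma mat_rows_mset_reindex:
  assumes f: "bij_betw f {..<n} {..<n}" and A: "A \<in> carrier_mat n n"
  shows "mat_rows_mset (mat n n (\<lambda>(i, j). A $$ (f i, f j))) = mat_rows_mset A"
proof -
  have "mat_rows_mset (mat n n (\<lambda>(i, j). A $$ (f i, f j))) =
      {#{#A $$ (f i, f j). j \<in># mset_set {..<n}#}. i \<in># mset_set {..<n}#}"
    by (auto simp: mat_rows_mset_def intro!: image_mset_cong)
  also have "\<dots> = {#{#A $$ (f i, j). j \<in># mset_set {..<n}#}. i \<in># mset_set {..<n}#}"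
    by (subst mset_set_image_bij[OF f]) (rule refl)
  also have "\<dots> = {#{#A $$ (i, j). j \<in># mset_set {..<n}#}. i \<in># mset_set {..<n}#}"
    by (rule mset_set_image_bij[OF f])
  finally show ?thesis using A by (simp add: mat_rows_mset_def)
qed

lemma mat_cols_mset_transpose: "mat_cols_mset A = mat_rows_mset (transpose_mat A)"
  by (auto simp: mat_cols_mset_def mat_rows_mset_def intro!: image_mset_cong)

lemma mat_cols_mset_reindex:
  assumes f: "bij_betw f {..<n} {..<n}" and A: "A \<in> carrier_mat n n"
  shows "mat_cols_mset (mat n n (\<lambda>(i, j). A $$ (f i, f j))) = mat_cols_mset A"
proof -
  have fn: "f i < n" if "i < n" for i using f that by (auto simp: bij_betw_def)
  have "transpose_mat (mat n n (\<lambda>(i, j). A $$ (f i, f j))) =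
      mat n n (\<lambda>(i, j). transpose_mat A $$ (f i, f j))"
    using fn A by (intro eq_matI) auto
  then show ?thesis
    using mat_rows_mset_reindex[OF f, of "transpose_mat A"] A
    by (simp add: mat_cols_mset_transpose)
qed

lemma det_reindex:
  fixes A :: "'a :: comm_ring_1 mat"
  assumes f: "bij_betw f {..<n} {..<n}" and A: "A \<in> carrier_mat n n"
  shows "det (mat n n (\<lambda>(i, j). A $$ (f i, f j))) = det A"
proof -
  define p where "p = (\<lambda>i. if i < n then f i else i)"
  have p: "p permutes {0..<n}"
  proof (rule bij_imp_permutes)
    have "bij_betw p {..<n} {..<n}"
      using f by (subst bij_betw_cong[of _ _ f]) (auto simp: p_def)
    then show "bij_betw p {0..<n} {0..<n}" by (simp add: lessThan_atLeast0)
  qed (auto simp: p_def)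
  have pn: "p i < n" if "i < n" for i
    using f that by (auto simp: p_def bij_betw_def)
  define C where "C = mat n n (\<lambda>(i, j). A $$ (i, p j))"
  have C: "C \<in> carrier_mat n n" by (simp add: C_def)
  have "mat n n (\<lambda>(i, j). A $$ (f i, f j)) = mat n n (\<lambda>(i, j). C $$ (p i, j))"
    using pn by (intro eq_matI) (auto simp: C_def p_def)
  then have "det (mat n n (\<lambda>(i, j). A $$ (f i, f j))) = signof p * det C"
    using det_permute_rows[OF C p] by simp
  also have "transpose_mat C = mat n n (\<lambda>(i, j). transpose_mat A $$ (p i, j))"
    using pn A by (intro eq_matI) (auto simp: C_def)
  then have "det C = signof p * det A"
    using det_permute_rows[of "transpose_mat A" n p] p A C det_transpose[OF C] det_transpose[OF A]
    by simp
  finally show ?thesis by (simp add: sign_def)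
qed

lemma rank_reindex_le:
  fixes A :: "'a :: field mat"
  assumes f: "bij_betw f {..<n} {..<n}" and A: "A \<in> carrier_mat n n"
  shows "vec_space.rank n A \<le> vec_space.rank n (mat n n (\<lambda>(i, j). A $$ (f i, f j)))"
proof -
  interpret vec_space "TYPE('a)" n .
  define B where "B = mat n n (\<lambda>(i, j). A $$ (f i, f j))"
  have B: "B \<in> carrier_mat n n" by (simp add: B_def)
  define h :: "'a vec \<Rightarrow> 'a vec" where "h v = vec n (\<lambda>i. v $ f i)" for v
  have fn: "f i < n" if "i < n" for i using f that by (auto simp: bij_betw_def)
  have surj: "\<exists>i<n. k = f i" if "k < n" for k
    using f that by (auto simp: bij_betw_def image_iff Bex_def dest: equalityD2)
  have inj: "inj_on h (carrier_vec n)"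
  proof (rule inj_onI)
    fix v w :: "'a vec" assume vw: "v \<in> carrier_vec n" "w \<in> carrier_vec n" "h v = h w"
    show "v = w"
    proof (rule eq_vecI)
      fix k assume "k < dim_vec w"
      then obtain i where i: "i < n" "k = f i" using surj[of k] vw by auto
      then show "v $ k = w $ k" using arg_cong[OF vw(3), of "\<lambda>x. x $ i"] by (simp add: h_def)
    qed (use vw in auto)
  qed
  have "\<exists>U. finite U \<and> maximal U (\<lambda>T. T \<subseteq> set (cols A) \<and> lin_indpt T) \<and> {} \<subseteq> U"
  proof (rule maximal_exists_superset[of "set (cols A)"])
    show "{} \<subseteq> set (cols A) \<and> lin_indpt {}" by (simp add: finite_lin_indpt2)
  qed auto
  then obtain U where U: "maximal U (\<lambda>T. T \<subseteq> set (cols A) \<and> lin_indpt T)" by blast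
  then have Us: "U \<subseteq> set (cols A)" and Ui: "lin_indpt U" by (auto simp: maximal_def)
  have Uc: "U \<subseteq> carrier_vec n" using Us A cols_dim by blast
  have "h ` U \<subseteq> set (cols B)"
  proof
    fix w assume "w \<in> h ` U"
    then obtain j where j: "j < n" "w = h (col A j)"
      using Us A by (auto simp: cols_def)
    then obtain l where l: "l < n" "j = f l" using surj by blast
    have "w = col B l"
      using j l fn A by (intro eq_vecI) (auto simp: h_def B_def)
    then show "w \<in> set (cols B)" using l B by (auto simp: cols_def)
  qed
  moreover have "lin_indpt (h ` U)"
  proof
    assume "lin_dep (h ` U)"
    then obtain T a v where T: "finite T" "T \<subseteq> h ` U" "lincomb a T = 0\<^sub>v n" "v \<in> T" "a v \<noteq> 0"
      unfolding lin_dep_def by auto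
    obtain T' where T': "T' \<subseteq> U" "T = h ` T'" using T(2) by (meson subset_imageE)
    have injT: "inj_on h T'" using inj T' Uc by (meson inj_on_subset order_trans)
    have fin: "finite T'" using T(1) T' injT by (simp add: finite_image_iff)
    have T'c: "T' \<subseteq> carrier_vec n" using T' Uc by blast
    have hc: "h x \<in> carrier_vec n" for x by (simp add: h_def)
    have "lincomb (a \<circ> h) T' = 0\<^sub>v n"
    proof (rule eq_vecI)
      fix k assume "k < dim_vec (0\<^sub>v n :: 'a vec)"
      then obtain i where i: "i < n" "k = f i" using surj[of k] by auto
      have "lincomb (a \<circ> h) T' $ k = (\<Sum>x\<in>T'. a (h x) * x $ k)"
        using i fn T'c by (subst lincomb_index) auto
      also have "\<dots> = (\<Sum>x\<in>T'. a (h x) * h x $ i)" using i by (simp add: h_def)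
      also have "\<dots> = (\<Sum>y\<in>T. a y * y $ i)" using injT T' by (simp add: sum.reindex)
      also have "\<dots> = lincomb a T $ i"
        using i T' hc by (subst lincomb_index) auto
      finally show "lincomb (a \<circ> h) T' $ k = 0\<^sub>v n $ k" using T(3) i fn by simp
    qed (use T'c fin lincomb_dim in auto)
    moreover obtain u where "u \<in> T'" "(a \<circ> h) u \<noteq> 0" using T(4,5) T' by auto
    ultimately have "lin_dep U"
      unfolding lin_dep_def using fin T'(1)
      by (intro exI[of _ T'] exI[of _ "a \<circ> h"] exI[of _ u]) auto
    then show False using Ui by simp
  qed
  ultimately have "card (h ` U) \<le> rank B" by (intro rank_ge_card_indpt[OF B])
  moreover have "card (h ` U) = card U"
    using inj Uc by (intro card_image) (rule inj_on_subset)
  moreover have "rank A = card U" by (rule rank_card_indpt[OF A U])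
  ultimately show ?thesis by (simp add: B_def)
qed

lemma rank_reindex:
  fixes A :: "'a :: field mat"
  assumes f: "bij_betw f {..<n} {..<n}" and A: "A \<in> carrier_mat n n"
  shows "vec_space.rank n (mat n n (\<lambda>(i, j). A $$ (f i, f j))) = vec_space.rank n A"
proof (rule antisym)
  let ?B = "mat n n (\<lambda>(i, j). A $$ (f i, f j))"
  let ?g = "the_inv_into {..<n} f"
  have g: "bij_betw ?g {..<n} {..<n}" by (rule bij_betw_the_inv_into[OF f])
  have gn: "?g i < n" "f (?g i) = i" if "i < n" for i
    using that f g by (auto simp: bij_betw_def f_the_inv_into_f)
  have "mat n n (\<lambda>(i, j). ?B $$ (?g i, ?g j)) = A"
    using gn A by (intro eq_matI) auto
  then show "vec_space.rank n ?B \<le> vec_space.rank n A"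
    using rank_reindex_le[OF g, of ?B] by simp
qed (rule rank_reindex_le[OF f A])

lemma braid_rank_eq: "\<pi> permutes {1..n} \<Longrightarrow> braid_rank n B = vec_space.rank n (ou_matrix n B \<pi>)"
  by (simp add: braid_rank_def ou_matrix_reindex[of \<pi>] rank_reindex reindex_bij)

lemma braid_det_eq: "\<pi> permutes {1..n} \<Longrightarrow> braid_det n B = det (ou_matrix n B \<pi>)"
  by (simp add: braid_det_def ou_matrix_reindex[of \<pi>] det_reindex reindex_bij)

lemma over_crossing_set_eq:
  "\<pi> permutes {1..n} \<Longrightarrow> over_crossing_set n B = mat_rows_mset (ou_matrix n B \<pi>)"
  by (simp add: over_crossing_set_def ou_matrix_reindex[of \<pi>] mat_rows_mset_reindex reindex_bij)

lemma under_crossing_set_eq: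
  "\<pi> permutes {1..n} \<Longrightarrow> under_crossing_set n B = mat_cols_mset (ou_matrix n B \<pi>)"
  by (simp add: under_crossing_set_def ou_matrix_reindex[of \<pi>] mat_cols_mset_reindex reindex_bij)

end

theory Submission
  imports Defs
begin

text \<open>Count the crossings at which strand \<open>a\<close> passes over strand \<open>b\<close> with their signs. Each Artin
  relation preserves this number: the two crossings of a cancelling pair have the same over-strand
  and the same under-strand but opposite signs, and both sides of a positive relation have the same
  (over, under) pairs. On a positive diagram the signed count is the plain one, so the whole
  OU matrix is an invariant.\<close>

fun signed_over_count :: "(nat \<Rightarrow> nat) \<Rightarrow> crossing list \<Rightarrow> nat \<times> nat \<Rightarrow> int" where
  "signed_over_count p [] q = 0"
| "signed_over_count p (Gen k # B) q =
    of_bool (q = (p (k + 1), p k)) + signed_over_count (p(k := p (k + 1), k + 1 := p k)) B q"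
| "signed_over_count p (GenInv k # B) q =
    signed_over_count (p(k := p (k + 1), k + 1 := p k)) B q - of_bool (q = (p k, p (k + 1)))"

text \<open>Besides contributing equally, both sides hand the strands to \<open>v\<close> in the
  same order, so the counts below agree too.\<close>

lemma signed_over_count_relation:
  assumes "braid_relation n r r'"
  shows "signed_over_count p (r @ v) q = signed_over_count p (r' @ v) q"
  using assms
proof cases
  case (far i j)
  \<comment> \<open>The two swaps act on disjoint pairs of positions, as
    \<open>i + 2 \<le> j\<close>.\<close>
  then have "p(i := p (i + 1), i + 1 := p i, j := p (j + 1), j + 1 := p j) =
      p(j := p (j + 1), j + 1 := p j, i := p (i + 1), i + 1 := p i)"
    by (auto simp: fun_eq_iff)
  with far show ?thesis by simp
\<comment> \<open>For strands x, y, z, both sides of \<open>braid\<close> yield the pairs (y,x),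
  (z,x), (z,y), in opposite orders, and leave z, y, x.\<close>
qed (simp_all add: fun_upd_twist)

text \<open>The assumption ranges over all \<open>p\<close> because \<open>u\<close> permutes the
  strands before they reach \<open>v\<close>.\<close>

lemma signed_over_count_context:
  assumes "\<And>p. signed_over_count p v q = signed_over_count p v' q"
  shows "signed_over_count p (u @ v) q = signed_over_count p (u @ v') q"
proof (induction u arbitrary: p)
  case (Cons c u)
  show ?case
    by (cases c) (simp_all only: append_Cons signed_over_count.simps Cons.IH)
qed (simp add: assms)

lemma signed_over_count_step:
  "braid_step n B B' \<Longrightarrow> signed_over_count p B q = signed_over_count p B' q"
  by (auto elim!: braid_step.cases intro!: signed_over_count_context signed_over_count_relation)

text \<open>The connecting chain may pass through non-positive words, hence the signs.\<close>

lemma signed_over_count_same_braid: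
  assumes "same_braid n B B'"
  shows "signed_over_count p B q = signed_over_count p B' q"
proof -
  have "equivclp (braid_step n) B B'"
    using assms by (simp add: same_braid_def)
  then show ?thesis
    by (induction rule: equivclp_induct) (auto dest: signed_over_count_step[of n _ _ p q])
qed

lemma signed_over_count_positive:
  assumes "\<forall>c\<in>set B. is_Gen c"
  shows "signed_over_count p B q = int (count_list (crossings p B) q)"
  using assms
proof (induction B arbitrary: p)
  case (Cons c B)
  then show ?case by (cases c) auto
qed simp

lemma over_count_positive_invariant:
  assumes "positive_braid_diagram n B" "positive_braid_diagram n B'" "same_braid n B B'"
  shows "over_count B = over_count B'"
  using assms signed_over_count_same_braid[OF assms(3), of id]
  by (simp add: fun_eq_iff over_count_def positive_braid_diagram_def signed_over_count_positive)

theorem corollary4: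
  fixes n :: nat and B B' :: "crossing list"
  assumes "n \<ge> 1"
    and "positive_braid_diagram n B"
    and "positive_braid_diagram n B'"
    and "same_braid n B B'"
  shows "braid_rank n B = braid_rank n B' \<and>
    braid_det n B = braid_det n B' \<and>
    over_crossing_set n B = over_crossing_set n B' \<and>
    under_crossing_set n B = under_crossing_set n B'"
proof -
  \<comment> \<open>The matrix depends on the diagram only through
    \<open>over_count\<close>.\<close>
  have "ou_matrix n B = ou_matrix n B'"
    using over_count_positive_invariant[OF assms(2-4)] by (simp only: ou_matrix_def[abs_def])
  then show ?thesis
    by (simp add: braid_rank_def braid_det_def over_crossing_set_def under_crossing_set_def)
qed

end
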